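(* Let $p\geq5$ be a prime and $G=\mathrm{GL}_2(\mathbb{F}_p)$. Let $\Delta=\{(g,h)\in G\times G:\det g=\det h\}$. Every subgroup $H\leq\Delta$ whose projections to both factors $G$ are surjective is $(G\times G)$-conjugate to exactly one of $\Gamma_{\mathrm{id}}$, $\Gamma_\chi$, $H_\pm$, $\Delta$.
   Context: Let $\chi$ be the quadratic character (Legendre symbol) of $\mathbb{F}_p^\times$. The subgroups of $G\times G$ are: $\Gamma_{\mathrm{id}}=\{(g,g):g\in G\}$; $\Gamma_\chi=\{(g,\chi(\det g)g):g\in G\}$; $H_\pm=\{(g,\pm g):g\in G\}$ (both signs allowed). *)

theory Defs
  imports
    "HOL-Analysis.Determinants"
    "HOL-Algebra.Coset"
    "HOL-Number_Theory.Residues"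
    "Berlekamp_Zassenhaus.Finite_Field"
begin

text \<open>The field of p elements is \<^typ>\<open>'p mod_ring\<close> with \<^typ>\<open>'p\<close> of class
  \<^class>\<open>prime_card\<close>; the prime is the cardinality of \<^typ>\<open>'p\<close>.\<close>

definition GL2 :: "('p::prime_card mod_ring ^ 2 ^ 2) monoid" where
  "GL2 = \<lparr>carrier = {A. invertible A}, mult = (**), one = mat 1\<rparr>"

lemma group_GL2: "group GL2"
proof (rule groupI)
  fix x :: "'p::prime_card mod_ring ^ 2 ^ 2"
  assume "x \<in> carrier GL2"
  then show "\<exists>y\<in>carrier GL2. y \<otimes>\<^bsub>GL2\<^esub> x = \<one>\<^bsub>GL2\<^esub>"
    unfolding GL2_def invertible_def by auto
next
  show "\<one>\<^bsub>GL2\<^esub> \<in> carrier GL2"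
    unfolding GL2_def invertible_def by (auto intro: exI[of _ "mat 1"])
qed (auto simp: GL2_def invertible_mult matrix_mul_assoc)

text \<open>On units the Legendre symbol is 1 or -1; it is read back in the field so that it can scale
  matrices.\<close>

definition quad_char :: "'p::prime_card mod_ring \<Rightarrow> 'p mod_ring" where
  "quad_char a = of_int (Legendre (to_int_mod_ring a) (int CARD('p)))"

definition Gamma_id :: "(('p::prime_card mod_ring ^ 2 ^ 2) \<times> ('p mod_ring ^ 2 ^ 2)) set" where
  "Gamma_id = {(g, g) | g. g \<in> carrier GL2}"

definition Gamma_chi :: "(('p::prime_card mod_ring ^ 2 ^ 2) \<times> ('p mod_ring ^ 2 ^ 2)) set" where
  "Gamma_chi = {(g, mat (quad_char (det g)) ** g) | g. g \<in> carrier GL2}"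

definition H_pm :: "(('p::prime_card mod_ring ^ 2 ^ 2) \<times> ('p mod_ring ^ 2 ^ 2)) set" where
  "H_pm = {(g, g) | g. g \<in> carrier GL2} \<union> {(g, - g) | g. g \<in> carrier GL2}"

definition Delta :: "(('p::prime_card mod_ring ^ 2 ^ 2) \<times> ('p mod_ring ^ 2 ^ 2)) set" where
  "Delta = {(g, h). g \<in> carrier GL2 \<and> h \<in> carrier GL2 \<and> det g = det h}"

definition conjugate_in :: "('a, 'b) monoid_scheme \<Rightarrow> 'a set \<Rightarrow> 'a set \<Rightarrow> bool" where
  "conjugate_in G H K \<longleftrightarrow>
    (\<exists>x \<in> carrier G. K = x <#\<^bsub>G\<^esub> H #>\<^bsub>G\<^esub> inv\<^bsub>G\<^esub> x)"

end

theory Submission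
  imports Defs "HOL-Number_Theory.Euler_Criterion"
begin

text \<open>Goursat's lemma, made elementary. If some (A, 1) in H has A different from 1 and -1, then the
  elements g with (g, 1) in H form a normal subgroup of GL2 inside SL2 that contains a non-scalar
  matrix, hence all of SL2, and H is Delta; likewise on the other side. Otherwise H is, up to signs,
  the graph of an isomorphism. The standard upper and lower unipotents are then matched with a pair
  of unipotents that a single y conjugates back to the standard pair; as these generate SL2, H
  contains (s, y s y^(-1)) for all s in SL2, and therefore every (g, h) in H satisfies
  h = y g y^(-1) or h = - y g y^(-1). The sign is ambiguous if (1, -1) is in H. If it is not, the
  sign depends only on the square class of the determinant, so it is trivial or the quadratic
  character. The four cases are separated by whether (1, -1) is in H and by the equality, possibly
  up to sign, of the traces of the two components.\<close>

section \<open>Two-by-two matrices in coordinates\<close>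

definition mat2 :: "'a \<Rightarrow> 'a \<Rightarrow> 'a \<Rightarrow> 'a \<Rightarrow> 'a ^ 2 ^ 2" where
  "mat2 a b c d = (\<chi> i j. if i = 1 then if j = 1 then a else b else if j = 1 then c else d)"

lemma mat2_nth [simp]:
  "mat2 a b c d $ 1 $ 1 = a" "mat2 a b c d $ 1 $ 2 = b"
  "mat2 a b c d $ 2 $ 1 = c" "mat2 a b c d $ 2 $ 2 = d"
  by (simp_all add: mat2_def)

lemma mat2_exhaust:
  fixes A :: "'a ^ 2 ^ 2"
  obtains a b c d where "A = mat2 a b c d"
  by (rule that[of "A$1$1" "A$1$2" "A$2$1" "A$2$2"]) (simp add: vec_eq_iff forall_2)

lemma mat2_eq_iff [simp]:
  "mat2 a b c d = mat2 a' b' c' d' \<longleftrightarrow> a = a' \<and> b = b' \<and> c = c' \<and> d = d'"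
  by (auto simp: vec_eq_iff forall_2)

lemma mat2_mult [simp]:
  "mat2 a b c d ** mat2 a' b' c' d' =
    mat2 (a * a' + b * c') (a * b' + b * d') (c * a' + d * c') (c * b' + d * (d'::'a::semiring_1))"
  by (simp add: vec_eq_iff forall_2 matrix_matrix_mult_def sum_2)

lemma mat_eq_mat2: "mat x = mat2 x 0 0 (x::'a::zero)"
  by (simp add: vec_eq_iff forall_2 mat_def)

lemma uminus_mat2 [simp]: "- mat2 a b c d = mat2 (- a) (- b) (- c) (- d :: 'a::ab_group_add)"
  by (simp add: vec_eq_iff forall_2)

lemma det_mat2 [simp]: "det (mat2 a b c d) = a * d - b * (c::'a::comm_ring_1)"
  by (simp add: det_2)

lemma trace_mat2 [simp]: "trace (mat2 a b c d) = a + (d::'a::semiring_1)"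
  by (simp add: trace_def sum_2)

lemma trace_uminus2: "trace (- A) = - trace (A :: 'a::comm_ring_1 ^ 2 ^ 2)"
  by (rule mat2_exhaust[of A]) simp

lemma det_uminus2 [simp]: "det (- A) = det (A :: 'a::comm_ring_1 ^ 2 ^ 2)"
  by (rule mat2_exhaust[of A]) simp

lemma det_mat_2 [simp]: "det (mat c :: 'a::comm_ring_1 ^ 2 ^ 2) = c * c"
  by (simp add: mat_eq_mat2)

lemma mat_minus_1: "- mat 1 = (mat (- 1) :: 'a::comm_ring_1 ^ 2 ^ 2)"
  by (simp add: mat_eq_mat2)

lemma mult_uminus2 [simp]:
  fixes A B :: "'a::comm_ring_1 ^ 2 ^ 2"
  shows
  "- A ** B = - (A ** B)"
  "A ** - B = - (A ** B)"
proof -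
  obtain a b c d a' b' c' d' where "A = mat2 a b c d" "B = mat2 a' b' c' d'"
    by (metis mat2_exhaust)
  then show "- A ** B = - (A ** B)" "A ** - B = - (A ** B)" by simp_all
qed

lemma mat_scalar_commute: "mat c ** A = (A :: 'a::comm_ring_1 ^ 2 ^ 2) ** mat c"
  by (rule mat2_exhaust[of A]) (simp add: mat_eq_mat2 algebra_simps)

lemma inverse_exists2:
  fixes A :: "'a::field ^ 2 ^ 2"
  assumes "det A \<noteq> 0"
  obtains A' where "A ** A' = mat 1" "A' ** A = mat 1"
proof (rule mat2_exhaust[of A])
  fix a b c d assume A: "A = mat2 a b c d"
  define D where "D = a * d - b * c"
  have "D \<noteq> 0" using assms A by (simp add: D_def)
  moreover have "a * (d / D) + b * (- c / D) = (a * d - b * c) / D"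
    "c * (- b / D) + d * (a / D) = (a * d - b * c) / D"
    by (simp_all add: diff_divide_distrib mult.commute)
  ultimately have "mat2 a b c d ** mat2 (d / D) (- b / D) (- c / D) (a / D) = mat 1"
    by (simp add: mat_eq_mat2 mult.commute flip: D_def)
  then show thesis using that A matrix_left_right_inverse by metis
qed

lemma det_nz_of_inverse:
  fixes A :: "'a::field ^ 2 ^ 2"
  assumes "A ** A' = mat 1"
  shows "det A \<noteq> 0" "det A * det A' = 1" "A' ** A = mat 1"
proof -
  show *: "det A * det A' = 1" using assms det_mul[of A A'] by simp
  then show "det A \<noteq> 0" by auto
  show "A' ** A = mat 1" using assms matrix_left_right_inverse by blast
qed

lemma inverse_cancel:
  fixes x :: "'a::field ^ 2 ^ 2"
  assumes "x ** x' = mat 1"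
  shows "x ** (x' ** A) = A" "x' ** (x ** A) = A" "A ** x ** x' = A" "A ** x' ** x = A"
proof -
  note i = assms det_nz_of_inverse(3)[OF assms]
  show "x ** (x' ** A) = A" "x' ** (x ** A) = A" using i by (simp_all add: matrix_mul_assoc)
  show "A ** x ** x' = A" "A ** x' ** x = A" using i by (simp_all flip: matrix_mul_assoc)
qed

lemma trace_conj:
  fixes x :: "'a::field ^ 2 ^ 2"
  assumes "x ** x' = mat 1"
  shows "trace (x ** A ** x') = trace A"
  by (metis assms inverse_cancel(2) trace_mul_sym matrix_mul_assoc)

text \<open>The off-diagonal entries of \<open>A ** A\<close> and the difference of its diagonal
  entries are b, c and a - d, each times the trace; a nonzero trace therefore makes A
  scalar.\<close>

lemma trace_0_of_scalar_square:
  fixes A :: "'a::field ^ 2 ^ 2"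
  assumes "A ** A = mat e"
  shows "trace A = 0 \<or> (\<exists>x. A = mat x)"
proof -
  obtain a b c d where A: "A = mat2 a b c d" by (rule mat2_exhaust)
  have "b * (a + d) = 0" "c * (a + d) = 0" "(a - d) * (a + d) = 0"
    using assms by (auto simp: A mat_eq_mat2 algebra_simps)
  then show ?thesis by (auto simp: A mat_eq_mat2)
qed

section \<open>Generators of SL2 and normal closure of a non-scalar matrix\<close>

text \<open>A matrix with c \<noteq> 0 factors as upper, lower, upper shear. If c = 0, adding the
  first row to the second leads back to that case.\<close>

lemma SL2_generated:
  fixes S :: "('a::field ^ 2 ^ 2) set"
  assumes mult: "\<And>A B. A \<in> S \<Longrightarrow> B \<in> S \<Longrightarrow> A ** B \<in> S"
    and upper: "\<And>b. mat2 1 b 0 1 \<in> S" and lower: "\<And>b. mat2 1 0 b 1 \<in> S"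
    and "det A = 1"
  shows "A \<in> S"
proof (rule mat2_exhaust[of A])
  have main: "mat2 a b c d \<in> S" if "c \<noteq> 0" "a * d - b * c = 1" for a b c d
  proof -
    have "mat2 1 ((a - 1) / c) 0 1 ** mat2 1 0 c 1 ** mat2 1 ((d - 1) / c) 0 1 \<in> S"
      by (intro mult upper lower)
    also have "mat2 1 ((a - 1) / c) 0 1 ** mat2 1 0 c 1 ** mat2 1 ((d - 1) / c) 0 1 = mat2 a b c d"
      using that by (simp add: field_simps)
    finally show ?thesis .
  qed
  fix a b c d assume A: "A = mat2 a b c d"
  show "A \<in> S"
  proof (cases "c = 0")
    case False
    then show ?thesis using main assms A by simp
  next
    case True
    with assms A have ad: "a * d = 1" by simp
    then have "a \<noteq> 0" by auto
    then have "mat2 a b a (b + d) \<in> S" using ad by (intro main) (auto simp: algebra_simps)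
    then have "mat2 1 0 (- 1) 1 ** mat2 a b a (b + d) \<in> S" by (intro mult lower)
    then show ?thesis using A True by simp
  qed
qed

text \<open>N is normalised by all of GL2, so diagonal matrices of any nonzero determinant may
  conjugate. A non-scalar matrix is brought to companion form; two commutators then yield a
  nontrivial shear, and its conjugates by diagonal matrices and by the coordinate swap are the
  generators of \<open>SL2_generated\<close>.\<close>

lemma normal_SL2:
  fixes N :: "('a::field ^ 2 ^ 2) set"
  assumes two: "(2::'a) \<noteq> 0" and three: "(3::'a) \<noteq> 0"
    and mult: "\<And>A B. A \<in> N \<Longrightarrow> B \<in> N \<Longrightarrow> A ** B \<in> N"
    and inv: "\<And>A A'. A \<in> N \<Longrightarrow> A ** A' = mat 1 \<Longrightarrow> A' \<in> N"
    and conj: "\<And>A x x'. A \<in> N \<Longrightarrow> x ** x' = mat 1 \<Longrightarrow> x ** A ** x' \<in> N"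
    and A: "A \<in> N" "det A = 1" "\<And>c. A \<noteq> mat c"
    and "det s = 1"
  shows "s \<in> N"
proof -
  have companion: "\<exists>t. mat2 0 (- 1) 1 t \<in> N"
    if "mat2 a b c d \<in> N" "c \<noteq> 0" "a * d - b * c = 1" for a b c d
  proof -
    \<comment> \<open>Base change to e1 and its image (a, c), independent because c \<noteq>
      0.\<close>
    have "mat2 1 (- a / c) 0 (1 / c) ** mat2 a b c d ** mat2 1 a 0 c \<in> N"
      using that by (intro conj) (auto simp: mat_eq_mat2)
    also have "mat2 1 (- a / c) 0 (1 / c) ** mat2 a b c d ** mat2 1 a 0 c = mat2 0 (- 1) 1 (a + d)"
      using that by (simp add: field_simps)
    finally show ?thesis by blast
  qed
  obtain t where t: "mat2 0 (- 1) 1 t \<in> N"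
  proof (rule mat2_exhaust[of A])
    fix a b c d assume A': "A = mat2 a b c d"
    have D: "a * d - b * c = 1" using A A' by simp
    have "\<exists>t. mat2 0 (- 1) 1 t \<in> N"
    proof (cases "c = 0")
      case False
      then show ?thesis using companion A A' D by blast
    next
      case c: True
      show ?thesis
      proof (cases "b = 0")
        case False
        have "mat2 0 1 1 0 ** A ** mat2 0 1 1 0 \<in> N"
          using A by (intro conj) (auto simp: mat_eq_mat2)
        then have "mat2 d c b a \<in> N" using A' by simp
        then show ?thesis using companion False D by (simp add: algebra_simps)
      next
        case True
        then have "a \<noteq> d" using A A' c by (auto simp: mat_eq_mat2)
        \<comment> \<open>A shear gives a diagonal matrix with distinct entries the lower left entry
          a - d.\<close>
        have "mat2 1 0 1 1 ** A ** mat2 1 0 (- 1) 1 \<in> N"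
          using A by (intro conj) (auto simp: mat_eq_mat2)
        then have "mat2 a 0 (a - d) d \<in> N" using A' c True by simp
        then show ?thesis using companion[of a 0 "a - d" d] \<open>a \<noteq> d\<close> D True by simp
      qed
    qed
    then show thesis using that by blast
  qed
  have "(4::'a) = 2 * 2" "(8::'a) = 2 * 2 * 2" by simp_all
  then have four: "(4::'a) \<noteq> 0" and eight: "(8::'a) \<noteq> 0"
    using two by (metis mult_eq_0_iff)+
  \<comment> \<open>The commutator of the companion matrix with diag(2, 1) is triangular with
    eigenvalues 1/2 and 2, whatever t is.\<close>
  have "mat2 t 1 (- 1) 0 \<in> N" using t by (rule inv) (simp add: mat_eq_mat2)
  moreover have "mat2 2 0 0 1 ** mat2 0 (- 1) 1 t ** mat2 (1/2) 0 0 1 \<in> N"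
    using two by (intro conj t) (simp add: mat_eq_mat2)
  ultimately have "mat2 t 1 (- 1) 0 ** (mat2 2 0 0 1 ** mat2 0 (- 1) 1 t ** mat2 (1/2) 0 0 1) \<in> N"
    by (rule mult)
  then have M: "mat2 (1/2) (- t) 0 2 \<in> N" using two by simp
  have M': "mat2 2 t 0 (1/2) \<in> N" using M by (rule inv) (use two in \<open>simp add: mat_eq_mat2\<close>)
  \<comment> \<open>A second commutator, now with a shear, cancels t: the eigenvalue ratio 1/4
    leaves the entry 1 - 1/4 = 3/4, nonzero because 3 is.\<close>
  have "mat2 1 1 0 1 ** mat2 (1/2) (- t) 0 2 ** mat2 1 (- 1) 0 1 \<in> N"
    using M by (intro conj) (auto simp: mat_eq_mat2)
  then have "(mat2 1 1 0 1 ** mat2 (1/2) (- t) 0 2 ** mat2 1 (- 1) 0 1) ** mat2 2 t 0 (1/2) \<in> N"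
    using M' by (rule mult)
  also have "(mat2 1 1 0 1 ** mat2 (1/2) (- t) 0 2 ** mat2 1 (- 1) 0 1) ** mat2 2 t 0 (1/2) =
      mat2 1 (3/4) 0 1"
    using two four eight by (simp add: field_simps)
  finally have T: "mat2 1 (3/4) 0 1 \<in> N" .
  define q :: 'a where "q = 3/4"
  have q: "mat2 1 q 0 1 \<in> N" "q \<noteq> 0" using T three four by (simp_all add: q_def)
  have upper: "mat2 1 b 0 1 \<in> N" for b
  proof (cases "b = 0")
    case True
    have "mat2 1 q 0 1 ** mat2 1 (- q) 0 1 \<in> N"
      by (intro mult inv[OF q(1)] q) (simp add: mat_eq_mat2)
    then show ?thesis using True by simp
  next
    case False
    have "mat2 (b / q) 0 0 1 ** mat2 1 q 0 1 ** mat2 (q / b) 0 0 1 \<in> N"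
      using q False by (intro conj) (simp_all add: mat_eq_mat2)
    then show ?thesis using False q by simp
  qed
  have lower: "mat2 1 0 b 1 \<in> N" for b
    using conj[OF upper[of b], of "mat2 0 1 1 0" "mat2 0 1 1 0"] by (simp add: mat_eq_mat2)
  show ?thesis using mult upper lower \<open>det s = 1\<close> by (rule SL2_generated)
qed

section \<open>Subdirect subgroups of the fibre product over the determinant\<close>

text \<open>Phrased with matrix products alone, so that any one-sided inverse can be used. The
  conditions are symmetric, and \<open>converse\<close> carries each result to the other
  factor.\<close>

locale subdirect =
  fixes H :: "(('a::field ^ 2 ^ 2) \<times> ('a ^ 2 ^ 2)) set"
  assumes mult: "(g, h) \<in> H \<Longrightarrow> (g', h') \<in> H \<Longrightarrow> (g ** g', h ** h') \<in> H"
    and inv: "(g, h) \<in> H \<Longrightarrow> g ** g' = mat 1 \<Longrightarrow> h ** h' = mat 1 \<Longrightarrow> (g', h') \<in> H"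
    and det_eq: "(g, h) \<in> H \<Longrightarrow> det g = det h"
    and unit: "(g, h) \<in> H \<Longrightarrow> det g \<noteq> 0"
    and left: "det g \<noteq> 0 \<Longrightarrow> \<exists>h. (g, h) \<in> H"
    and right: "det h \<noteq> 0 \<Longrightarrow> \<exists>g. (g, h) \<in> H"
    and two: "(2::'a) \<noteq> 0" and three: "(3::'a) \<noteq> 0"
begin

lemma converse: "subdirect (H\<inverse>)"
proof
  show "\<exists>h. (g, h) \<in> H\<inverse>" if "det g \<noteq> 0" for g using right that by auto
  show "\<exists>g. (g, h) \<in> H\<inverse>" if "det h \<noteq> 0" for h using left that by auto
  show "(g ** g', h ** h') \<in> H\<inverse>" if "(g, h) \<in> H\<inverse>" "(g', h') \<in> H\<inverse>" for g h g' h'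
    using mult that by simp
  show "(g', h') \<in> H\<inverse>" if "(g, h) \<in> H\<inverse>" "g ** g' = mat 1" "h ** h' = mat 1" for g h g' h'
    using inv that by simp
  show "det g = det h" if "(g, h) \<in> H\<inverse>" for g h using det_eq that by simp
  show "det g \<noteq> 0" if "(g, h) \<in> H\<inverse>" for g h using unit det_eq that by simp
qed (fact two three)+

lemma lift:
  assumes "(g, h) \<in> H"
  obtains g' h' where "g ** g' = mat 1" "h ** h' = mat 1" "(g', h') \<in> H"
proof -
  have "det g \<noteq> 0" "det h \<noteq> 0" using unit det_eq assms by auto
  then show thesis using that inv assms inverse_exists2 by metis
qed

lemma one: "(mat 1, mat 1) \<in> H"
proof -
  obtain h where "(mat 1, h) \<in> H" using left[of "mat 1"] by auto
  moreover from this obtain g' h' where "mat 1 ** g' = mat 1" "h ** h' = mat 1" "(g', h') \<in> H"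
    by (rule lift)
  ultimately show ?thesis using mult by force
qed

text \<open>Surjectivity on the left makes the kernel N normal in GL2: conjugating (B, 1) by (x, k)
  keeps the second component 1. Once N contains SL2, first components of equal determinant can be
  exchanged over the same h.\<close>

lemma eq_fiber_product:
  assumes A: "(A, mat 1) \<in> H" "A \<noteq> mat 1" "A \<noteq> - mat 1"
  shows "H = {(g, h). det g \<noteq> 0 \<and> det g = det h}"
proof -
  define N where "N = {A. (A, mat 1) \<in> H}"
  have SL2: "s \<in> N" if "det s = 1" for s
  proof (rule normal_SL2[OF two three, where A = A])
    show "B ** C \<in> N" if "B \<in> N" "C \<in> N" for B C using that mult N_def by fastforce
    show "B' \<in> N" if "B \<in> N" "B ** B' = mat 1" for B B' using that inv N_def by fastforce
    show "x ** B ** x' \<in> N" if B: "B \<in> N" and x: "x ** x' = mat 1" for B x x'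
    proof -
      obtain k where k: "(x, k) \<in> H" using left det_nz_of_inverse(1)[OF x] by blast
      then obtain x'' k' where k': "k ** k' = mat 1" "(x'', k') \<in> H" "x ** x'' = mat 1"
        by (metis lift)
      then have "(x', k') \<in> H" using inv k x by blast
      then have "(x ** B ** x', k ** mat 1 ** k') \<in> H" using B k by (intro mult) (auto simp: N_def)
      then show ?thesis using k' by (simp add: N_def)
    qed
    show "A \<in> N" using A by (simp add: N_def)
    show "det A = 1" using det_eq[OF A(1)] by simp
    then show "A \<noteq> mat c" for c
      using A by (auto simp: mat_minus_1 square_eq_1_iff)
    show "det s = 1" by fact
  qed
  show ?thesis
  proof (intro equalityI subsetI; clarify)
    show "(g, h) \<in> H" if gh: "det g \<noteq> 0" "det g = det h" for g h
    proof -
      obtain g1 where g1: "(g1, h) \<in> H" using right gh by metis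
      then have d: "det g1 = det g" "det g1 \<noteq> 0" using det_eq unit gh by auto
      then obtain g' where g': "g1 ** g' = mat 1" using inverse_exists2 by metis
      have "det (g ** g') = 1" using det_nz_of_inverse(2)[OF g'] d by (simp add: det_mul)
      then have "(g ** g' ** g1, mat 1 ** h) \<in> H" using SL2 g1 by (intro mult) (auto simp: N_def)
      then show ?thesis using inverse_cancel(4)[OF g'] by simp
    qed
  qed (use unit det_eq in auto)
qed

end

section \<open>Subgroups that are graphs up to sign\<close>

locale projective_subdirect = subdirect +
  assumes ker_fst: "(A, mat 1) \<in> H \<Longrightarrow> A = mat 1 \<or> A = - mat 1"
    and ker_snd: "(mat 1, A) \<in> H \<Longrightarrow> A = mat 1 \<or> A = - mat 1"
begin

lemma projective_converse: "projective_subdirect (H\<inverse>)"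
  using converse ker_fst ker_snd
  by (simp add: projective_subdirect_def projective_subdirect_axioms_def)

lemma snd_unique:
  assumes "(g, h) \<in> H" "(g, h') \<in> H"
  shows "h' = h \<or> h' = - h"
proof -
  obtain g1 h1 where i: "g ** g1 = mat 1" "h ** h1 = mat 1" "(g1, h1) \<in> H"
    using lift assms(1) by blast
  then have "(mat 1, h1 ** h') \<in> H"
    using mult[OF i(3) assms(2)] det_nz_of_inverse(3)[OF i(1)] by simp
  then have "h1 ** h' = mat 1 \<or> h1 ** h' = - mat 1" by (rule ker_snd)
  then have "h ** (h1 ** h') = h \<or> h ** (h1 ** h') = - h" by auto
  then show ?thesis using inverse_cancel(1)[OF i(2)] by simp
qed

lemma minus_mem:
  assumes "(g, h) \<in> H" "(g, - h) \<in> H"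
  shows "(mat 1, - mat 1) \<in> H"
proof -
  obtain g1 h1 where i: "g ** g1 = mat 1" "h ** h1 = mat 1" "(g1, h1) \<in> H"
    using lift assms(1) by blast
  then show ?thesis using mult[OF assms(2) i(3)] by simp
qed

text \<open>Since \<open>mat c\<close> is central, the products with (g, k) in either order have the
  same first component, so by \<open>snd_unique\<close> h commutes up to sign with every invertible
  k. Testing the two standard shears leaves only scalars, as h is invertible.\<close>

lemma scalar_fst:
  assumes "(mat c, h) \<in> H"
  shows "\<exists>d. h = mat d"
proof (rule mat2_exhaust[of h])
  fix a b c' d assume h: "h = mat2 a b c' d"
  have comm: "h ** k = k ** h \<or> h ** k = - (k ** h)" if k: "det k \<noteq> 0" for k
  proof -
    obtain g where g: "(g, k) \<in> H" using right[OF k] by blast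
    show ?thesis
      using snd_unique[OF mult[OF g assms]] mult[OF assms g] by (metis mat_scalar_commute)
  qed
  have *: "x = 0" if "x = - x" for x :: 'a
    using that two by (metis add.right_inverse mult_2 mult_eq_0_iff)
  have "det h \<noteq> 0" using unit det_eq assms by metis
  then show ?thesis
    using comm[of "mat2 1 1 0 1"] comm[of "mat2 1 0 1 1"] *[of c'] *[of b] *[of a] *[of d]
    by (auto simp: h mat_eq_mat2)
qed

text \<open>Since u is conjugate to its square and its cube, h is so up to sign. This gives two equations
  for the trace of h, whose only common solutions are 2 and -2 as 3 is nonzero.\<close>

lemma unipotent_image:
  assumes "x ** x' = mat 1" "x ** u ** x' = u ** u"
    and "y ** y' = mat 1" "y ** u ** y' = u ** u ** u"
    and "det u = 1"
  shows "\<exists>h. (u, h) \<in> H \<and> det h = 1 \<and> trace h = 2"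
proof -
  obtain h where h: "(u, h) \<in> H" using left[of u] assms(5) by auto
  have dh: "det h = 1" using det_eq[OF h] assms by simp
  \<comment> \<open>Conjugation by x on the left lifts to conjugation by a partner k of x on the
    right.\<close>
  have conj: "\<exists>k k'. k ** k' = mat 1 \<and> (x ** u ** x', k ** h ** k') \<in> H"
    if x: "x ** x' = mat 1" for x x' :: "'a ^ 2 ^ 2"
  proof -
    obtain k where k: "(x, k) \<in> H" using left det_nz_of_inverse(1)[OF x] by blast
    then obtain x'' k' where k': "k ** k' = mat 1" "(x'', k') \<in> H" "x ** x'' = mat 1"
      by (metis lift)
    then have "(x', k') \<in> H" using inv[OF k x] by blast
    then have "(x ** u ** x', k ** h ** k') \<in> H" by (intro mult k h)
    then show ?thesis using k' by blast
  qed
  obtain k k' where k: "k ** k' = mat 1" "(u ** u, k ** h ** k') \<in> H" using conj assms by metis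
  obtain l l' where l: "l ** l' = mat 1" "(u ** u ** u, l ** h ** l') \<in> H" using conj assms by metis
  have h2: "(u ** u, h ** h) \<in> H" using mult[OF h h] .
  have h3: "(u ** u ** u, h ** h ** h) \<in> H" using mult[OF h2 h] .
  have e2: "k ** h ** k' = h ** h \<or> k ** h ** k' = - (h ** h)" using snd_unique[OF h2 k(2)] .
  have e3: "l ** h ** l' = h ** h ** h \<or> l ** h ** l' = - (h ** h ** h)" using snd_unique[OF h3 l(2)] .
  define t where "t = trace h"
  \<comment> \<open>Cayley-Hamilton with determinant 1.\<close>
  have tr: "trace (h ** h) = t * t - 2 \<and> trace (h ** h ** h) = t * t * t - 3 * t"
  proof (rule mat2_exhaust[of h])
    fix a b c d assume *: "h = mat2 a b c d"
    have bc: "b * c = a * d - 1" using dh * by (simp add: algebra_simps)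
    have "a * a + b * c + (c * b + d * d) = (a + d) * (a + d) - 2"
      using bc by Groebner_Basis.algebra
    moreover have "(a * a + b * c) * a + (a * b + b * d) * c +
        ((c * a + d * c) * b + (c * b + d * d) * d) = (a + d) * (a + d) * (a + d) - 3 * (a + d)"
      using bc by Groebner_Basis.algebra
    ultimately show ?thesis by (simp add: * t_def)
  qed
  have t2: "t = t * t - 2 \<or> t = - (t * t - 2)"
    using trace_conj[OF k(1), of h] e2 tr by (metis t_def trace_uminus2)
  have t3: "t = t * t * t - 3 * t \<or> t = - (t * t * t - 3 * t)"
    using trace_conj[OF l(1), of h] e3 tr by (metis t_def trace_uminus2)
  have t4: "t = 2 \<or> t = -2"
  proof -
    have "(t - 2) * (t + 1) = t * t - 2 - t" "(t + 2) * (t - 1) = t + (t * t - 2)"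
      by (simp_all add: algebra_simps)
    with t2 have "(t - 2) * (t + 1) = 0 \<or> (t + 2) * (t - 1) = 0"
      by (metis add.right_inverse neg_eq_iff_add_eq_0 right_minus_eq add.inverse_inverse)
    \<comment> \<open>The square alone would also allow t = 1 and t = -1; the cube excludes
      them.\<close>
    moreover have "t * t \<noteq> 1"
    proof
      assume "t * t = 1"
      with t3 have "t = t - 3 * t \<or> t = - (t - 3 * t)" by simp
      then have "3 * t = 0 \<or> t = 0"
      proof
        assume "t = - (t - 3 * t)"
        then have "t = 2 * t" by (simp add: algebra_simps)
        also have "2 * t = t + t" by (rule mult_2)
        finally have "t = 0" by (rule add_cancel_right_right[THEN iffD1])
        then show ?thesis ..
      qed simp
      then have "t = 0" using three by simp
      with \<open>t * t = 1\<close> show False by simp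
    qed
    then have "t + 1 \<noteq> 0" "t - 1 \<noteq> 0" by (auto simp: add_eq_0_iff2)
    ultimately have "t - 2 = 0 \<or> t + 2 = 0" by simp
    then show ?thesis by (metis eq_neg_iff_add_eq_0 right_minus_eq)
  qed
  show ?thesis
  proof (cases "t = 2")
    case True
    then show ?thesis using h dh by (auto simp: t_def)
  next
    case False
    then have t: "t = - 2" using t4 by simp
    \<comment> \<open>For t = -2 the traces force the minus sign in \<open>e2\<close>. This puts (1,
      -1) in H, so h may be replaced by - h.\<close>
    have "trace (k ** h ** k') = - 2" "trace (h ** h) = 2"
      using trace_conj[OF k(1), of h] tr t by (simp_all add: t_def)
    then have "k ** h ** k' \<noteq> h ** h" using False t by metis
    then have "(u ** u, - (h ** h)) \<in> H" using e2 k by metis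
    then have "(mat 1, - mat 1) \<in> H" by (rule minus_mem[OF h2])
    from mult[OF h this] have "(u, - h) \<in> H" by simp
    moreover have "det (- h) = 1" "trace (- h) = 2"
      using dh t by (simp_all add: trace_uminus2 t_def)
    ultimately show ?thesis by blast
  qed
qed

text \<open>For the unipotents u, v on the left, w = u v^(-1) u squares to -1, so its partner
  h h'^(-1) h has a scalar square without being scalar; hence it has trace 0, which is the
  condition on the trace of h h'.\<close>

lemma unipotent_pair:
  obtains h h' where "(mat2 1 1 0 1, h) \<in> H" "(mat2 1 0 1 1, h') \<in> H"
    "det h = 1" "trace h = 2" "det h' = 1" "trace h' = 2" "trace (h ** h') = 3"
proof -
  let ?u = "mat2 1 1 0 1 :: 'a ^ 2 ^ 2" and ?v = "mat2 1 0 1 1 :: 'a ^ 2 ^ 2"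
  \<comment> \<open>Conjugation by diag(2, 1) and diag(3, 1) multiplies the entry of the shear by 2
    and 3, giving its square and cube.\<close>
  obtain h where h: "(?u, h) \<in> H" "det h = 1" "trace h = 2"
    using unipotent_image[of "mat2 2 0 0 1" "mat2 (1/2) 0 0 1" ?u "mat2 3 0 0 1" "mat2 (1/3) 0 0 1"]
      two three by (auto simp: mat_eq_mat2)
  obtain h' where h': "(?v, h') \<in> H" "det h' = 1" "trace h' = 2"
    using unipotent_image[of "mat2 1 0 0 2" "mat2 1 0 0 (1/2)" ?v "mat2 1 0 0 3" "mat2 1 0 0 (1/3)"]
      two three by (auto simp: mat_eq_mat2)
  obtain v1 h1 where i: "?v ** v1 = mat 1" "h' ** h1 = mat 1" "(v1, h1) \<in> H"
    using lift h' by blast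
  have v1: "v1 = mat2 1 0 (- 1) 1"
    by (rule mat2_exhaust[of v1]) (use i(1) in \<open>auto simp: mat_eq_mat2 add_eq_0_iff\<close>)
  define w where "w = h ** h1 ** h"
  have w: "(mat2 0 1 (- 1) 0, w) \<in> H"
    using mult[OF mult[OF h(1) i(3)] h(1)] by (simp add: v1 w_def)
  then have "(mat (- 1), w ** w) \<in> H" using mult[OF w w] by (simp add: mat_eq_mat2)
  then obtain d where "w ** w = mat d" using scalar_fst by blast
  \<comment> \<open>\<open>scalar_fst\<close> with the factors exchanged: a scalar w would have a
    scalar partner.\<close>
  moreover have "w \<noteq> mat e" for e
  proof
    assume "w = mat e"
    interpret c: projective_subdirect "H\<inverse>" by (rule projective_converse)
    have "(mat e, mat2 0 1 (- 1) 0) \<in> H\<inverse>" using w \<open>w = mat e\<close> by simp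
    from c.scalar_fst[OF this] show False by (auto simp: mat_eq_mat2)
  qed
  ultimately have tr: "trace w = 0" using trace_0_of_scalar_square by blast
  \<comment> \<open>Behind this is Cayley-Hamilton: h1 = 2 - h' and h^2 = 2h - 1, so the trace of w
    = h (2 - h') h is 4 - (2 trace (hh') - 2).\<close>
  have "trace w = 6 - 2 * trace (h ** h')"
  proof -
    obtain a b c d where H: "h = mat2 a b c d" by (rule mat2_exhaust)
    obtain a' b' c' d' where H': "h' = mat2 a' b' c' d'" by (rule mat2_exhaust)
    have d: "d = 2 - a" "d' = 2 - a'" using h h' H H' by (auto simp: algebra_simps)
    have e: "b * c = a * d - 1" "b' * c' = a' * d' - 1" using h h' H H' by (auto simp: algebra_simps)
    have "h' ** mat2 d' (- b') (- c') a' = mat 1" using e by (simp add: H' mat_eq_mat2 algebra_simps)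
    then have "h1 = mat2 d' (- b') (- c') a'" using i(2) by (metis inverse_cancel(2))
    then have h1: "h1 = mat2 (2 - a') (- b') (- c') a'" by (simp add: d)
    show ?thesis using e(1) unfolding w_def H H' h1 d mat2_mult trace_mat2 by Groebner_Basis.algebra
  qed
  then have "2 * (3 - trace (h ** h')) = 0" using tr by (simp add: algebra_simps)
  then have "trace (h ** h') = 3" using two by (simp only: mult_eq_0_iff) simp
  then show thesis using that h h' by blast
qed

end

text \<open>The first column of y spans the image of h - 1, and h' - 1 maps it to the second column.\<close>

lemma unipotent_pair_conjugate:
  fixes h h' :: "'a::field ^ 2 ^ 2"
  assumes "det h = 1" "trace h = 2" "det h' = 1" "trace h' = 2" "trace (h ** h') = 3"
  shows "\<exists>y. det y \<noteq> 0 \<and> h ** y = y ** mat2 1 1 0 1 \<and> h' ** y = y ** mat2 1 0 1 1"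
proof -
  obtain a b c d where H: "h = mat2 a b c d" by (rule mat2_exhaust)
  obtain a' b' c' d' where H': "h' = mat2 a' b' c' d'" by (rule mat2_exhaust)
  define r r' where "r = a - 1" and "r' = a' - 1"
  have a: "a = 1 + r" "d = 1 - r" "a' = 1 + r'" "d' = 1 - r'"
    using assms by (auto simp: H H' r_def r'_def algebra_simps)
  have e: "b * c = - (r * r)" "b' * c' = - (r' * r')"
    using assms(1,3) unfolding H H' a det_mat2 by Groebner_Basis.algebra+
  \<comment> \<open>The left side is the trace of (h - 1)(h' - 1).\<close>
  have t: "2 * r * r' + b * c' + c * b' = 1"
  proof -
    have "trace (h ** h') = 2 + (2 * r * r' + b * c' + c * b')"
      unfolding H H' a mat2_mult trace_mat2 by Groebner_Basis.algebra
    then have "2 + (2 * r * r' + b * c' + c * b') = 2 + (1::'a)" using assms(5) by simp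
    then show ?thesis by (rule add_left_imp_eq)
  qed
  show ?thesis
  proof (cases "b = 0")
    case False
    have "b * c' + r * r' = 1 - r * r' - c * b'" using t by Groebner_Basis.algebra
    \<comment> \<open>First column: the second column (b, -r) of h - 1. Second column: its image
      under h' - 1.\<close>
    then have "det (mat2 b (r' * b - b' * r) (- r) (c' * b + r' * r)) = b"
      unfolding det_mat2 using t e by Groebner_Basis.algebra
    moreover have "h ** mat2 b (r' * b - b' * r) (- r) (c' * b + r' * r) =
        mat2 b (r' * b - b' * r) (- r) (c' * b + r' * r) ** mat2 1 1 0 1"
      unfolding H a mat2_mult mat2_eq_iff
        by (intro conjI; (use t e in Groebner_Basis.algebra | simp add: algebra_simps))
    moreover have "h' ** mat2 b (r' * b - b' * r) (- r) (c' * b + r' * r) =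
        mat2 b (r' * b - b' * r) (- r) (c' * b + r' * r) ** mat2 1 0 1 1"
      unfolding H' a mat2_mult mat2_eq_iff
        by (intro conjI; (use t e in Groebner_Basis.algebra | simp add: algebra_simps))
    ultimately show ?thesis using False by metis
  next
    case True
    then have r: "r = 0" and t': "c * b' = 1" using e t by auto
    \<comment> \<open>Only the entry c of h - 1 survives, so (0, c) takes the place of (b,
      -r).\<close>
    have "det (mat2 0 (b' * c) c (- r' * c)) = - c"
      unfolding det_mat2 using t' by Groebner_Basis.algebra
    moreover have "h ** mat2 0 (b' * c) c (- r' * c) = mat2 0 (b' * c) c (- r' * c) ** mat2 1 1 0 1"
      unfolding H a mat2_mult mat2_eq_iff r True
        by (intro conjI; (use t' in Groebner_Basis.algebra | simp add: algebra_simps))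
    moreover have "h' ** mat2 0 (b' * c) c (- r' * c) = mat2 0 (b' * c) c (- r' * c) ** mat2 1 0 1 1"
      unfolding H' a mat2_mult mat2_eq_iff
        by (intro conjI; (use t' e in Groebner_Basis.algebra | simp add: algebra_simps))
    moreover have "c \<noteq> 0" using t' by auto
    ultimately show ?thesis by (metis neg_equal_0_iff_equal)
  qed
qed

text \<open>Over a prime field the powers of the two standard shears are all shears, so matching one
  unipotent pair gives conjugation by y on all of SL2. An arbitrary (g, k) in H is then controlled
  by how it conjugates unipotents.\<close>

lemma (in projective_subdirect) inner_up_to_sign:
  assumes prime_field: "\<And>x::'a. \<exists>n. x = of_nat n"
  obtains y y' where "y ** y' = mat 1"
    "\<And>s. det s = 1 \<Longrightarrow> (s, y ** s ** y') \<in> H"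
    "\<And>g h. (g, h) \<in> H \<Longrightarrow> h = y ** g ** y' \<or> h = - (y ** g ** y')"
proof -
  let ?u = "mat2 1 1 0 1 :: 'a ^ 2 ^ 2" and ?v = "mat2 1 0 1 1 :: 'a ^ 2 ^ 2"
  obtain h h' where h: "(?u, h) \<in> H" "(?v, h') \<in> H"
    "det h = 1" "trace h = 2" "det h' = 1" "trace h' = 2" "trace (h ** h') = 3"
    by (rule unipotent_pair)
  obtain y where "det y \<noteq> 0" and hy: "h ** y = y ** ?u" "h' ** y = y ** ?v"
    using unipotent_pair_conjugate h by blast
  then obtain y' where y: "y ** y' = mat 1" using inverse_exists2 by metis
  define S where "S = {s. (s, y ** s ** y') \<in> H}"
  have Smult: "s ** s' \<in> S" if "s \<in> S" "s' \<in> S" for s s'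
  proof -
    have "(s ** s', (y ** s ** y') ** (y ** s' ** y')) \<in> H" using that mult by (simp add: S_def)
    moreover have "(y ** s ** y') ** (y ** s' ** y') = y ** (s ** s') ** y'"
      by (simp add: matrix_mul_assoc inverse_cancel(4)[OF y])
    ultimately show ?thesis by (simp add: S_def)
  qed
  have "y ** ?u ** y' = h" "y ** ?v ** y' = h'"
    unfolding hy[symmetric] by (simp_all add: inverse_cancel(3)[OF y])
  then have uv: "?u \<in> S" "?v \<in> S" using h by (simp_all add: S_def)
  have S1: "mat 1 \<in> S" using one y by (simp add: S_def)
  have SL2: "s \<in> S" if "det s = 1" for s
  proof (rule SL2_generated[OF Smult _ _ that])
    show "mat2 1 b 0 1 \<in> S" for b
    proof -
      have "mat2 1 (of_nat n) 0 1 \<in> S" for n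
      proof (induction n)
        case (Suc n)
        show ?case using Smult[OF uv(1) Suc] by (simp add: add.commute)
      qed (use S1 in \<open>simp add: mat_eq_mat2\<close>)
      then show ?thesis using prime_field[of b] by auto
    qed
    show "mat2 1 0 b 1 \<in> S" for b
    proof -
      have "mat2 1 0 (of_nat n) 1 \<in> S" for n
      proof (induction n)
        case (Suc n)
        show ?case using Smult[OF uv(2) Suc] by (simp add: add.commute)
      qed (use S1 in \<open>simp add: mat_eq_mat2\<close>)
      then show ?thesis using prime_field[of b] by auto
    qed
  qed
  have sign: "k = y ** g ** y' \<or> k = - (y ** g ** y')" if gk: "(g, k) \<in> H" for g k
  proof -
    obtain g' k' where i: "g ** g' = mat 1" "k ** k' = mat 1" "(g', k') \<in> H"
      using lift gk by blast
    note cancel = inverse_cancel[OF y] inverse_cancel[OF i(1)] inverse_cancel[OF i(2)]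
    \<comment> \<open>Here k = y (g z) y^(-1), so the claim is that z is 1 or -1. Commuting with the
      two standard shears will make z scalar.\<close>
    define z where "z = g' ** y' ** k ** y"
    have kz: "y ** g ** z = k ** y"
      unfolding z_def by (simp add: matrix_mul_assoc cancel y)
    have comm: "z ** s = s ** z" if s: "det s = 1" "trace s = 2" for s
    proof -
      have "(g ** s ** g', k ** (y ** s ** y') ** k') \<in> H"
        using mult[OF mult[OF gk] i(3)] SL2[OF s(1)] by (simp add: S_def)
      moreover have "(g ** s ** g', y ** (g ** s ** g') ** y') \<in> H"
        using SL2[of "g ** s ** g'"] det_nz_of_inverse(2)[OF i(1)] s
        by (simp add: S_def det_mul mult.commute)
      ultimately have "k ** (y ** s ** y') ** k' = y ** (g ** s ** g') ** y' \<or>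
          k ** (y ** s ** y') ** k' = - (y ** (g ** s ** g') ** y')"
        by (rule snd_unique[rotated])
      \<comment> \<open>Both sides have trace 2, and 2 \<noteq> -2 rules out the minus sign.\<close>
      moreover have "trace (k ** (y ** s ** y') ** k') = 2" "trace (y ** (g ** s ** g') ** y') = 2"
        using s by (simp_all add: trace_conj[OF i(1)] trace_conj[OF i(2)] trace_conj[OF y])
      moreover have "(2::'a) \<noteq> - 2"
        using two by (metis add.right_inverse mult_2 mult_eq_0_iff)
      ultimately have "k ** (y ** s ** y') ** k' = y ** (g ** s ** g') ** y'"
        by (metis trace_uminus2)
      then have "g' ** y' ** (k ** (y ** s ** y') ** k') ** k ** y =
          g' ** y' ** (y ** (g ** s ** g') ** y') ** k ** y" by (simp only:)
      then show ?thesis unfolding z_def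
        by (simp add: matrix_mul_assoc cancel det_nz_of_inverse(3)[OF i(1)])
    qed
    obtain c where c: "z = mat c"
    proof (rule mat2_exhaust[of z])
      fix a b c' d assume "z = mat2 a b c' d"
      then show thesis using comm[of ?u] comm[of ?v] that[of a] by (auto simp: mat_eq_mat2)
    qed
    \<comment> \<open>Determinants in \<open>kz\<close>, with det k = det g, give c^2 = 1.\<close>
    have "det y * (det g * (c * c)) = det y * (det g * 1)"
      using arg_cong[OF kz, of det] det_eq[OF gk] by (simp only: det_mul c det_mat_2 mult.assoc mult.commute mult.left_commute mult_1)
    then have "c * c = 1" using \<open>det y \<noteq> 0\<close> unit[OF gk] by (simp only: mult_cancel_left) simp
    then have "z = mat 1 \<or> z = - mat 1" by (auto simp: c mat_minus_1 square_eq_1_iff)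
    then have "k ** y = y ** g \<or> k ** y = - (y ** g)" using kz by auto
    then have "k ** y ** y' = y ** g ** y' \<or> k ** y ** y' = - (y ** g ** y')" by auto
    then show ?thesis by (simp add: inverse_cancel(3)[OF y])
  qed
  show thesis using that y SL2 sign by (simp add: S_def)
qed

section \<open>The group GL2 and the quadratic character\<close>

lemma mem_carrier_GL2: "A \<in> carrier GL2 \<longleftrightarrow> det A \<noteq> 0"
proof
  assume "A \<in> carrier GL2"
  then obtain A' where "A ** A' = mat 1" unfolding GL2_def invertible_def by auto
  then show "det A \<noteq> 0" by (rule det_nz_of_inverse)
next
  assume "det A \<noteq> 0"
  then obtain A' where "A ** A' = mat 1" "A' ** A = mat 1" by (rule inverse_exists2)
  then show "A \<in> carrier GL2" unfolding GL2_def invertible_def by auto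
qed

lemma inv_GL2:
  assumes "x ** x' = mat 1"
  shows "inv\<^bsub>GL2\<^esub> x = x'"
proof (rule group.inv_equality[OF group_GL2])
  show "x' \<otimes>\<^bsub>GL2\<^esub> x = \<one>\<^bsub>GL2\<^esub>"
    using det_nz_of_inverse(3)[OF assms] by (simp add: GL2_def)
  show "x \<in> carrier GL2" "x' \<in> carrier GL2"
    using det_nz_of_inverse(2)[OF assms] by (auto simp: mem_carrier_GL2)
qed

lemma of_int_to_int_mod_ring [simp]:
  "of_int (to_int_mod_ring a) = (a :: 'p::prime_card mod_ring)"
  by (simp add: of_int_of_int_mod_ring)

lemma of_int_mod_ring_eq_iff:
  "(of_int a :: 'p::prime_card mod_ring) = of_int b \<longleftrightarrow> [a = b] (mod int CARD('p))"
  by (simp add: of_int_eq_iff_cong_CHAR)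

text \<open>Euler's criterion read in the field; in this form multiplicativity is immediate, at 0 as
  well.\<close>

lemma quad_char_eq_power:
  fixes a :: "'p::prime_card mod_ring"
  assumes "CARD('p) > 2"
  shows "quad_char a = a ^ ((CARD('p) - 1) div 2)"
proof -
  have "[Legendre (to_int_mod_ring a) (int CARD('p)) =
      to_int_mod_ring a ^ ((CARD('p) - 1) div 2)] (mod int CARD('p))"
    using euler_criterion[OF prime_card assms] .
  then show ?thesis
    unfolding quad_char_def of_int_mod_ring_eq_iff[where ?'p = 'p, symmetric] by simp
qed

lemma quad_char_mult:
  fixes a b :: "'p::prime_card mod_ring"
  assumes "CARD('p) > 2"
  shows "quad_char (a * b) = quad_char a * quad_char b"
  using assms by (simp add: quad_char_eq_power power_mult_distrib)

lemma quad_char_if: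
  fixes a :: "'p::prime_card mod_ring"
  assumes "a \<noteq> 0"
  shows "quad_char a = (if \<exists>b. a = b * b then 1 else - 1)"
proof -
  have cong: "[x = to_int_mod_ring a] (mod int CARD('p)) \<longleftrightarrow> of_int x = a" for x
    using of_int_mod_ring_eq_iff[of x "to_int_mod_ring a", where ?'p = 'p] by simp
  have "\<not> [to_int_mod_ring a = 0] (mod int CARD('p))"
    using cong[of 0] assms by (simp add: cong_sym_eq)
  moreover have "QuadRes (int CARD('p)) (to_int_mod_ring a) \<longleftrightarrow> (\<exists>b. a = b * b)"
  proof -
    have "QuadRes (int CARD('p)) (to_int_mod_ring a) \<longleftrightarrow>
        (\<exists>y. a = of_int y * (of_int y :: 'p mod_ring))"
      by (simp only: QuadRes_def cong power2_eq_square of_int_mult eq_commute)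
    also have "\<dots> \<longleftrightarrow> (\<exists>b. a = b * b)" by (metis of_int_to_int_mod_ring)
    finally show ?thesis .
  qed
  ultimately show ?thesis by (simp add: quad_char_def Legendre_def)
qed

lemma numeral_neq_0_mod_ring:
  assumes "CARD('p::prime_card) \<ge> 5"
  shows "(2::'p mod_ring) \<noteq> 0" "(3::'p mod_ring) \<noteq> 0"
proof -
  have "of_nat n \<noteq> (0::'p mod_ring)" if "0 < n" "n < CARD('p)" for n
    using that of_nat_0_mod_ring_dvd[of n, where ?'a = 'p] nat_dvd_not_less by blast
  from this[of 2] this[of 3] show "(2::'p mod_ring) \<noteq> 0" "(3::'p mod_ring) \<noteq> 0"
    using assms by auto
qed

text \<open>Squaring identifies 1 and -1, so on a finite field it is not surjective either.\<close>

lemma exists_nonsquare: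
  assumes "(2::'p::prime_card mod_ring) \<noteq> 0"
  obtains d :: "'p::prime_card mod_ring" where "d \<noteq> 0" "quad_char d = - 1"
proof -
  have "\<not> inj (\<lambda>b::'p mod_ring. b * b)"
  proof
    assume "inj (\<lambda>b::'p mod_ring. b * b)"
    then have "(1::'p mod_ring) = - 1" by (rule injD) simp
    then have "(1::'p mod_ring) + 1 = 0" by (metis add.right_inverse)
    then show False using assms by simp
  qed
  then have "\<not> surj (\<lambda>b::'p mod_ring. b * b)" using finite_UNIV_surj_inj[OF finite] by blast
  then obtain d :: "'p mod_ring" where d: "\<And>b. d \<noteq> b * b" unfolding surj_def by blast
  then have "d \<noteq> 0" by (metis mult_zero_left)
  with d show thesis using that by (simp add: quad_char_if)
qed

section \<open>Conjugation in the product group and its invariants\<close>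

lemma conjugate_in_GL2_iff:
  fixes H K :: "(('p::prime_card mod_ring ^ 2 ^ 2) \<times> ('p mod_ring ^ 2 ^ 2)) set"
  shows "conjugate_in (GL2 \<times>\<times> GL2) H K \<longleftrightarrow>
    (\<exists>x x' y y'. x ** x' = mat 1 \<and> y ** y' = mat 1 \<and>
      K = (\<lambda>(g, h). (x ** g ** x', y ** h ** y')) ` H)"
proof -
  have inv: "inv\<^bsub>GL2 \<times>\<times> GL2\<^esub> (x, y) = (x', y')" if "x ** x' = mat 1" "y ** y' = mat 1"
    for x x' y y' :: "'p mod_ring ^ 2 ^ 2"
    using inv_GL2[OF that(1)] inv_GL2[OF that(2)]
      det_nz_of_inverse(1)[OF that(1)] det_nz_of_inverse(1)[OF that(2)]
    by (simp add: mem_carrier_GL2 group_GL2)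
  have coset: "p <#\<^bsub>GL2 \<times>\<times> GL2\<^esub> H #>\<^bsub>GL2 \<times>\<times> GL2\<^esub> (x', y') =
      (\<lambda>(g, h). (fst p ** g ** x', snd p ** h ** y')) ` H" for p x' y'
    by (force simp: l_coset_def r_coset_def mult_DirProd' GL2_def)
  show ?thesis
  proof
    assume "conjugate_in (GL2 \<times>\<times> GL2) H K"
    then obtain x y where xy: "x \<in> carrier GL2" "y \<in> carrier GL2"
      "K = (x, y) <#\<^bsub>GL2 \<times>\<times> GL2\<^esub> H #>\<^bsub>GL2 \<times>\<times> GL2\<^esub> inv\<^bsub>GL2 \<times>\<times> GL2\<^esub> (x, y)"
      unfolding conjugate_in_def by auto
    moreover from xy obtain x' y' where "x ** x' = mat 1" "y ** y' = mat 1"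
      unfolding mem_carrier_GL2 by (elim inverse_exists2)
    ultimately show "\<exists>x x' y y'. x ** x' = mat 1 \<and> y ** y' = mat 1 \<and>
        K = (\<lambda>(g, h). (x ** g ** x', y ** h ** y')) ` H"
      using inv coset by fastforce
  next
    assume "\<exists>x x' y y'. x ** x' = mat 1 \<and> y ** y' = mat 1 \<and>
        K = (\<lambda>(g, h). (x ** g ** x', y ** h ** y')) ` H"
    then obtain x x' y y' where xy: "x ** x' = mat 1" "y ** y' = mat 1"
      "K = (\<lambda>(g, h). (x ** g ** x', y ** h ** y')) ` H" by blast
    then have "(x, y) \<in> carrier (GL2 \<times>\<times> GL2)"
      by (auto simp: mem_carrier_GL2 det_nz_of_inverse(1))
    moreover have "K = (x, y) <#\<^bsub>GL2 \<times>\<times> GL2\<^esub> H #>\<^bsub>GL2 \<times>\<times> GL2\<^esub> inv\<^bsub>GL2 \<times>\<times> GL2\<^esub> (x, y)"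
      using coset[of "(x, y)" x' y'] inv[OF xy(1,2)] xy(3) by simp
    ultimately show "conjugate_in (GL2 \<times>\<times> GL2) H K"
      unfolding conjugate_in_def by blast
  qed
qed

text \<open>Conjugation acts on each factor separately and keeps both traces. Taking P as equality,
  or equality up to sign, gives two of the invariants that tell the four groups apart.\<close>

lemma conjugate_in_trace_iff:
  fixes H K :: "(('p::prime_card mod_ring ^ 2 ^ 2) \<times> ('p mod_ring ^ 2 ^ 2)) set"
  assumes "conjugate_in (GL2 \<times>\<times> GL2) H K"
  shows "(\<forall>(g, h)\<in>K. P (trace g) (trace h)) \<longleftrightarrow> (\<forall>(g, h)\<in>H. P (trace g) (trace h))"
proof -
  obtain x x' y y' where xy: "x ** x' = mat 1" "y ** y' = mat 1"
    "K = (\<lambda>(g, h). (x ** g ** x', y ** h ** y')) ` H"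
    using assms unfolding conjugate_in_GL2_iff by blast
  show ?thesis unfolding xy(3) by (auto simp: trace_conj[OF xy(1)] trace_conj[OF xy(2)] split_beta)
qed

lemma conjugate_in_minus_iff:
  fixes H K :: "(('p::prime_card mod_ring ^ 2 ^ 2) \<times> ('p mod_ring ^ 2 ^ 2)) set"
  assumes "conjugate_in (GL2 \<times>\<times> GL2) H K"
  shows "(mat 1, - mat 1) \<in> K \<longleftrightarrow> (mat 1, - mat 1) \<in> H"
proof -
  obtain x x' y y' where xy: "x ** x' = mat 1" "y ** y' = mat 1"
    "K = (\<lambda>(g, h). (x ** g ** x', y ** h ** y')) ` H"
    using assms unfolding conjugate_in_GL2_iff by blast
  have *: "A = mat c" if z: "z ** z' = mat 1" and A: "mat c = z ** A ** z'"
    for z z' A :: "'p mod_ring ^ 2 ^ 2" and c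
  proof -
    have "A = z' ** (z ** A ** z' ** z)"
      using inverse_cancel[OF z] by (simp flip: matrix_mul_assoc)
    also have "\<dots> = z' ** (z ** mat c)" by (simp only: mat_scalar_commute flip: A)
    finally show ?thesis by (simp only: inverse_cancel(2)[OF z])
  qed
  show ?thesis
  proof
    assume "(mat 1, - mat 1) \<in> K"
    then obtain g h where "(g, h) \<in> H" "mat 1 = x ** g ** x'" "mat (- 1) = y ** h ** y'"
      unfolding xy(3) mat_minus_1 by auto
    then show "(mat 1, - mat 1) \<in> H"
      using *[OF xy(1)] *[OF xy(2)] unfolding mat_minus_1 by metis
  next
    assume "(mat 1, - mat 1) \<in> H"
    then show "(mat 1, - mat 1) \<in> K" unfolding xy(3) by (rule rev_image_eqI) (simp add: xy)
  qed
qed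

section \<open>Determination of the sign\<close>

text \<open>After conjugation to K every pair is (g, g) or (g, - g). If (1, -1) is not in K, each
  invertible g has exactly one sign, and signs multiply. The sign is plus at square determinants; a
  single plus at a nonsquare one makes it plus everywhere, and otherwise it is the quadratic
  character.\<close>

lemma projective_subdirect_conjugate:
  fixes H :: "(('p::prime_card mod_ring ^ 2 ^ 2) \<times> ('p mod_ring ^ 2 ^ 2)) set"
  assumes "projective_subdirect H" and p: "CARD('p) > 2"
  shows "\<exists>K\<in>{Gamma_id, Gamma_chi, H_pm}. conjugate_in (GL2 \<times>\<times> GL2) H K"
proof -
  interpret projective_subdirect H by fact
  obtain y y' where y: "y ** y' = mat 1"
    and SL2: "\<And>s. det s = 1 \<Longrightarrow> (s, y ** s ** y') \<in> H"
    and sign: "\<And>g h. (g, h) \<in> H \<Longrightarrow> h = y ** g ** y' \<or> h = - (y ** g ** y')"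
    using inner_up_to_sign surj_of_nat_mod_ring by metis
  note y' = det_nz_of_inverse(3)[OF y]
  define K where "K = (\<lambda>(g, h). (mat 1 ** g ** mat 1, y' ** h ** y)) ` H"
  have K: "(g, k) \<in> K \<longleftrightarrow> (g, y ** k ** y') \<in> H" for g k
  proof
    assume "(g, k) \<in> K"
    then show "(g, y ** k ** y') \<in> H"
      by (auto simp: K_def matrix_mul_assoc inverse_cancel[OF y] y)
  next
    assume "(g, y ** k ** y') \<in> H"
    then show "(g, k) \<in> K" unfolding K_def
      by (rule rev_image_eqI) (simp add: matrix_mul_assoc inverse_cancel[OF y] y')
  qed
  have conj: "conjugate_in (GL2 \<times>\<times> GL2) H K"
    unfolding conjugate_in_GL2_iff K_def using y' matrix_mul_lid by blast
  have K_sign: "k = g \<or> k = - g" if "(g, k) \<in> K" for g k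
  proof -
    have "y' ** (y ** k ** y') ** y = y' ** (y ** g ** y') ** y \<or>
        y' ** (y ** k ** y') ** y = y' ** (- (y ** g ** y')) ** y"
      using sign that unfolding K by metis
    then show ?thesis by (simp add: matrix_mul_assoc inverse_cancel[OF y] y')
  qed
  have K_mult: "(g ** g', k ** k') \<in> K" if "(g, k) \<in> K" "(g', k') \<in> K" for g g' k k'
    using mult[of g "y ** k ** y'" g' "y ** k' ** y'"] that unfolding K
    by (simp add: matrix_mul_assoc inverse_cancel[OF y])
  have K_SL2: "(s, s) \<in> K" if "det s = 1" for s using SL2 that by (simp add: K)
  have K_det: "det g \<noteq> 0" if "(g, k) \<in> K" for g k using unit that by (simp add: K)
  have K_left: "(g, g) \<in> K \<or> (g, - g) \<in> K" if "det g \<noteq> 0" for g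
  proof -
    obtain h where "(g, h) \<in> H" using left \<open>det g \<noteq> 0\<close> by blast
    then show ?thesis using sign[of g h] by (auto simp: K)
  qed
  show ?thesis
  proof (cases "(mat 1, - mat 1) \<in> K")
    case True
    have "(g, - k) \<in> K" if "(g, k) \<in> K" for g k using K_mult[OF that True] by simp
    then have "(g, g) \<in> K \<and> (g, - g) \<in> K" if "det g \<noteq> 0" for g
      using K_left[OF that] by fastforce
    then have "K = H_pm"
      using K_sign K_det by (force simp: H_pm_def mem_carrier_GL2)
    then show ?thesis using conj by blast
  next
    case False
    have excl: "\<not> ((g, g) \<in> K \<and> (g, - g) \<in> K)" for g
      using minus_mem[of g "y ** g ** y'"] False by (auto simp: K y)
    have square: "(g, g) \<in> K" if g: "det g \<noteq> 0" "quad_char (det g) = 1" for g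
    proof -
      have "(1::'p mod_ring) \<noteq> - 1" using two by (metis add.right_inverse one_add_one)
      then have "\<exists>a. det g = a * a"
        using g(2) unfolding quad_char_if[OF g(1)] by (metis (full_types))
      then obtain a where a: "det g = a * a" ..
      then have a0: "a \<noteq> 0" using g by auto
      \<comment> \<open>D^2 has the determinant of g, and either sign of D cancels in the square, so
        (D^2, D^2) is in K. The quotient of g by D^2 lies in SL2.\<close>
      let ?D = "mat2 a 0 0 1"
      have "(?D ** ?D, ?D ** ?D) \<in> K"
        using K_left[of ?D] a0 K_mult[of ?D ?D ?D ?D] K_mult[of ?D "- ?D" ?D "- ?D"] by auto
      moreover obtain D' where D': "?D ** ?D ** D' = mat 1" "D' ** (?D ** ?D) = mat 1"
        using inverse_exists2[of "?D ** ?D"] a0 by auto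
      have "det (g ** D') = 1"
        using det_nz_of_inverse(2)[OF D'(1)] a by (simp add: det_mul)
      then have "(g ** D', g ** D') \<in> K" by (rule K_SL2)
      ultimately have "(g ** D' ** (?D ** ?D), g ** D' ** (?D ** ?D)) \<in> K" using K_mult by blast
      then show ?thesis using D' by (simp flip: matrix_mul_assoc del: mat2_mult)
    qed
    have quad: "quad_char (det g) = 1 \<or> quad_char (det g) = - 1" if "det g \<noteq> 0"
      for g :: "'p mod_ring ^ 2 ^ 2"
      by (simp add: quad_char_if[OF that])
    show ?thesis
    proof (cases "\<exists>g0. (g0, g0) \<in> K \<and> quad_char (det g0) = - 1")
      case True
      then obtain g0 where g0: "(g0, g0) \<in> K" "quad_char (det g0) = - 1" by blast
      have "(g, g) \<in> K" if g: "det g \<noteq> 0" for g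
      proof (rule ccontr)
        assume n: "(g, g) \<notin> K"
        then have "quad_char (det g) = - 1" "(g, - g) \<in> K"
          using square K_left quad g by blast+
        \<comment> \<open>Multiplication by g0 moves g into the square class, where the sign is
          plus, yet the product of the two signs is minus.\<close>
        then have "quad_char (det (g ** g0)) = 1" "(g ** g0, - (g ** g0)) \<in> K"
          using g0 K_mult[of g "- g" g0 g0] quad_char_mult[OF p] by (simp_all add: det_mul)
        moreover have "det (g ** g0) \<noteq> 0" using g K_det[OF g0(1)] by (simp add: det_mul)
        ultimately show False using square excl by blast
      qed
      then have "K = Gamma_id"
        using K_sign K_det excl by (force simp: Gamma_id_def mem_carrier_GL2)
      then show ?thesis using conj by blast
    next
      case False
      have scale: "mat 1 ** g = g" "mat (- 1) ** g = - g" for g :: "'p mod_ring ^ 2 ^ 2"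
        by (simp_all flip: mat_minus_1)
      \<comment> \<open>At nonsquare determinants plus never occurs, so \<open>K_left\<close> leaves
        minus.\<close>
      have mem: "(g, mat (quad_char (det g)) ** g) \<in> K" if g: "det g \<noteq> 0" for g
        using quad[OF g] square[OF g] False K_left[OF g] scale by metis
      have "k = mat (quad_char (det g)) ** g" if "(g, k) \<in> K" for g k
        using mem[OF K_det[OF that]] K_sign[OF that] quad[OF K_det[OF that]] excl[of g] that scale
        by metis
      then have "K = Gamma_chi"
        using mem K_det by (force simp: Gamma_chi_def mem_carrier_GL2)
      then show ?thesis using conj by blast
    qed
  qed
qed

section \<open>Existence and uniqueness of the conjugacy type\<close>

theorem theorem3p1:
  fixes H :: "(('p::prime_card mod_ring ^ 2 ^ 2) \<times> ('p mod_ring ^ 2 ^ 2)) set"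
  assumes "CARD('p) \<ge> 5"
    and "subgroup H (GL2 \<times>\<times> GL2)"
    and "H \<subseteq> Delta"
    and "fst ` H = carrier GL2"
    and "snd ` H = carrier GL2"
  shows "\<exists>!i. i < 4 \<and>
    conjugate_in (GL2 \<times>\<times> GL2) H ([Gamma_id, Gamma_chi, H_pm, Delta] ! i)"
proof -
  let ?L = "[Gamma_id, Gamma_chi, H_pm, Delta] ::
    (('p mod_ring ^ 2 ^ 2) \<times> ('p mod_ring ^ 2 ^ 2)) set list"
  note two = numeral_neq_0_mod_ring(1)[OF assms(1)]
  have one: "(1::'p mod_ring) \<noteq> - 1" using two by (metis add.right_inverse one_add_one)
  have Delta: "Delta = {(g, h :: 'p mod_ring ^ 2 ^ 2). det g \<noteq> 0 \<and> det g = det h}"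
    by (auto simp: Delta_def mem_carrier_GL2)
  interpret subdirect H
  proof
    show "(g ** g', h ** h') \<in> H" if "(g, h) \<in> H" "(g', h') \<in> H" for g h g' h'
      using subgroup.m_closed[OF assms(2) that] by (simp add: GL2_def)
    show "det g = det h" "det g \<noteq> 0" if "(g, h) \<in> H" for g h
      using that assms(3) by (auto simp: Delta)
    show "\<exists>h. (g, h) \<in> H" if "det g \<noteq> 0" for g
    proof -
      have "g \<in> fst ` H" using that assms(4) by (simp add: mem_carrier_GL2)
      then show ?thesis by force
    qed
    show "\<exists>g. (g, h) \<in> H" if "det h \<noteq> 0" for h
    proof -
      have "h \<in> snd ` H" using that assms(5) by (simp add: mem_carrier_GL2)
      then show ?thesis by force
    qed
    show "(g', h') \<in> H" if gh: "(g, h) \<in> H" "g ** g' = mat 1" "h ** h' = mat 1" for g h g' h'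
    proof -
      have "g \<in> carrier GL2" "h \<in> carrier GL2"
        using det_nz_of_inverse(1) gh by (auto simp: mem_carrier_GL2)
      then show ?thesis
        using subgroup.m_inv_closed[OF assms(2) gh(1)] inv_GL2[OF gh(2)] inv_GL2[OF gh(3)] by (simp add: group_GL2)
    qed
  qed (use numeral_neq_0_mod_ring[OF assms(1)] in auto)

  have exists: "\<exists>i<4. conjugate_in (GL2 \<times>\<times> GL2) H (?L ! i)"
  proof (cases "H = Delta")
    case True
    have "conjugate_in (GL2 \<times>\<times> GL2) H H"
      unfolding conjugate_in_GL2_iff
      by (intro exI[of _ "mat 1"]) simp
    then show ?thesis using True by (intro exI[of _ 3]) simp
  next
    case False
    interpret c: subdirect "H\<inverse>" by (rule converse)
    have "projective_subdirect H"
    proof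
      show "A = mat 1 \<or> A = - mat 1" if "(A, mat 1) \<in> H" for A
        by (rule ccontr) (use eq_fiber_product[OF that] False Delta in simp)
      show "A = mat 1 \<or> A = - mat 1" if "(mat 1, A) \<in> H" for A
      proof (rule ccontr)
        assume "\<not> ?thesis"
        \<comment> \<open>The fibre product is its own converse, so the other factor leads to
          \<open>Delta\<close> too.\<close>
        then have "H\<inverse> = {(g, h). det g \<noteq> 0 \<and> det g = det h}"
          using c.eq_fiber_product[of A] that by simp
        then have "H = Delta" unfolding Delta by (auto simp: set_eq_iff)
        then show False using False by simp
      qed
    qed
    then have "\<exists>K\<in>{Gamma_id, Gamma_chi, H_pm}. conjugate_in (GL2 \<times>\<times> GL2) H K"
      using assms(1) by (intro projective_subdirect_conjugate) auto
    then show ?thesis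
      using exI[of "\<lambda>i. i < 4 \<and> conjugate_in (GL2 \<times>\<times> GL2) H (?L ! i)" 0]
        exI[of "\<lambda>i. i < 4 \<and> conjugate_in (GL2 \<times>\<times> GL2) H (?L ! i)" 1]
        exI[of "\<lambda>i. i < 4 \<and> conjugate_in (GL2 \<times>\<times> GL2) H (?L ! i)" 2]
      by auto
  qed

  \<comment> \<open>\<open>central\<close> separates the first two groups from the last two;
    \<open>tr\<close> then separates \<open>Gamma_id\<close> from \<open>Gamma_chi\<close>, and
    \<open>tr_pm\<close> separates \<open>H_pm\<close> from \<open>Delta\<close>.\<close>
  define central where "central K \<longleftrightarrow> (mat 1, - mat 1) \<in> K"
    for K :: "(('p mod_ring ^ 2 ^ 2) \<times> ('p mod_ring ^ 2 ^ 2)) set"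
  define tr where "tr K \<longleftrightarrow> (\<forall>(g, h)\<in>K. trace g = trace h)"
    for K :: "(('p mod_ring ^ 2 ^ 2) \<times> ('p mod_ring ^ 2 ^ 2)) set"
  define tr_pm where "tr_pm K \<longleftrightarrow> (\<forall>(g, h)\<in>K. trace g = trace h \<or> trace g = - trace h)"
    for K :: "(('p mod_ring ^ 2 ^ 2) \<times> ('p mod_ring ^ 2 ^ 2)) set"
  have neg: "mat 1 \<noteq> - (mat 1 :: 'p mod_ring ^ 2 ^ 2)" using two by (simp add: mat_eq_mat2 two[symmetric])
  have q1: "quad_char (1 :: 'p mod_ring) = 1"
  proof -
    have "\<exists>b::'p mod_ring. 1 = b * b" by (rule exI[of _ 1]) simp
    then show ?thesis by (simp only: quad_char_if one_neq_zero not_False_eq_True if_True)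
  qed
  have "mat (quad_char (det (mat 1))) ** mat 1 = (mat 1 :: 'p mod_ring ^ 2 ^ 2)"
    by (simp add: q1 del: det_mat_2)
  then have central: "\<not> central Gamma_id" "\<not> central Gamma_chi"
    unfolding central_def Gamma_id_def Gamma_chi_def using neg by fastforce+
  have central': "central H_pm" "central Delta"
    by (simp_all add: central_def H_pm_def Delta mem_carrier_GL2)
  have tr: "tr Gamma_id" "tr_pm H_pm"
    by (auto simp: tr_def tr_pm_def Gamma_id_def H_pm_def trace_uminus2)
  have tr_chi: "\<not> tr Gamma_chi"
  proof -
    obtain d :: "'p mod_ring" where d: "d \<noteq> 0" "quad_char d = - 1"
      using exists_nonsquare[OF two] .
    \<comment> \<open>A matrix of nonsquare determinant d whose trace 1 makes the sign
      visible.\<close>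
    have "(mat2 0 (- d) 1 1, - mat2 0 (- d) 1 1) \<in> Gamma_chi"
      unfolding Gamma_chi_def mem_carrier_GL2 using d
      by (auto intro!: exI[of _ "mat2 0 (- d) 1 1"] simp flip: mat_minus_1)
    then have "trace (mat2 0 (- d) 1 1) = trace (- mat2 0 (- d) 1 1)" if "tr Gamma_chi"
      using that unfolding tr_def by fast
    then show ?thesis using one two by (auto simp: two[symmetric])
  qed
  have tr_Delta: "\<not> tr_pm Delta"
  proof -
    \<comment> \<open>Two matrices of determinant 1 with traces 2 and 0.\<close>
    have "(mat 1, mat2 0 (- 1) 1 0) \<in> (Delta :: (('p mod_ring ^ 2 ^ 2) \<times> _) set)"
      by (simp add: Delta mat_eq_mat2)
    then have "trace (mat 1 :: 'p mod_ring ^ 2 ^ 2) = trace (mat2 0 (- 1) 1 (0 :: 'p mod_ring)) \<or>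
        trace (mat 1 :: 'p mod_ring ^ 2 ^ 2) = - trace (mat2 0 (- 1) 1 (0 :: 'p mod_ring))" if "tr_pm Delta"
      using that unfolding tr_pm_def by blast
    then show ?thesis using two by (auto simp: mat_eq_mat2)
  qed
  have inv: "(central K \<longleftrightarrow> central H) \<and> (tr K \<longleftrightarrow> tr H) \<and> (tr_pm K \<longleftrightarrow> tr_pm H)"
    if "conjugate_in (GL2 \<times>\<times> GL2) H K" for K
    unfolding central_def tr_def tr_pm_def
    using conjugate_in_minus_iff[OF that] conjugate_in_trace_iff[OF that, of "(=)"]
      conjugate_in_trace_iff[OF that, of "\<lambda>a b. a = b \<or> a = - b"] by (intro conjI)
  have "i = j" if "i < 4" "j < 4" "conjugate_in (GL2 \<times>\<times> GL2) H (?L ! i)"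
    "conjugate_in (GL2 \<times>\<times> GL2) H (?L ! j)" for i j
  proof -
    have "central (?L ! i) = central (?L ! j)" "tr (?L ! i) = tr (?L ! j)"
      "tr_pm (?L ! i) = tr_pm (?L ! j)" using inv that(3,4) by blast+
    moreover have "i \<in> {0, 1, 2, 3}" "j \<in> {0, 1, 2, 3}" using that by auto
    ultimately show ?thesis using central central' tr tr_chi tr_Delta by auto
  qed
  with exists show ?thesis by blast
qed

end
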